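(* For $N\in\mathbb{N}$ and $K\ge 1$, let $P_U(N,K)$ denote the supremum of $\sup_{n\ge 1}\|A^n\|$ over all complex $N\times N$ matrices $A$ that satisfy the uniform Kreiss condition with constant $K$. Fix $\varepsilon>0$ and $m\in\mathbb{N}$. Then there exists a constant $C=C(\varepsilon,m)>0$ such that for all integers $N\ge 1$, $$P_U(N,1+\varepsilon)\ge C\,(\log N)^m .$$
   Context: $N\times N$ complex matrices act on $\mathbb{C}^N$ with the Euclidean norm, and $\|\cdot\|$ is the operator norm. A bounded operator $T$ on a Hilbert space satisfies the uniform Kreiss condition with constant $K$ if $$\Big\|\sum_{k=0}^n z^{-k-1}T^k\Big\|\le\frac{K}{|z|-1}\quad\text{for all }|z|>1\text{ and }n=0,1,2,\dots$$ *)

theory Defs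
  imports
    "HOL-Analysis.L2_Norm"
    "HOL-Library.Extended_Real"
    "Jordan_Normal_Form.Matrix"
begin

definition euclid_norm :: "complex vec \<Rightarrow> real" where
  "euclid_norm v = L2_set (\<lambda>i. cmod (v $ i)) {0..<dim_vec v}"

definition op_norm :: "complex mat \<Rightarrow> real" where
  "op_norm A = (SUP v\<in>{v \<in> carrier_vec (dim_col A). euclid_norm v \<le> 1}. euclid_norm (A *\<^sub>v v))"

text \<open>The supremum in \<^const>\<open>op_norm\<close> is taken over a nonempty set and is finite:\<close>

lemma op_norm_nonempty: "{v \<in> carrier_vec n. euclid_norm v \<le> 1} \<noteq> {}"
proof -
  have "0\<^sub>v n \<in> {v \<in> carrier_vec n. euclid_norm v \<le> 1}"
    by (simp add: euclid_norm_def L2_set_def)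
  then show ?thesis by blast
qed

lemma op_norm_bdd_above:
  "bdd_above ((\<lambda>v. euclid_norm (A *\<^sub>v v)) ` {v \<in> carrier_vec (dim_col A). euclid_norm v \<le> 1})"
proof (rule bdd_aboveI2)
  fix v assume "v \<in> {v \<in> carrier_vec (dim_col A). euclid_norm v \<le> 1}"
  then have dim: "dim_vec v = dim_col A" and v: "euclid_norm v \<le> 1" by auto
  have entry: "cmod (v $ j) \<le> 1" if "j < dim_col A" for j
  proof -
    have "cmod (v $ j) \<le> euclid_norm v"
      unfolding euclid_norm_def using that dim by (intro member_le_L2_set) auto
    with v show ?thesis by simp
  qed
  have "euclid_norm (A *\<^sub>v v) \<le> (\<Sum>i\<in>{0..<dim_row A}. cmod ((A *\<^sub>v v) $ i))"
    unfolding euclid_norm_def dim_mult_mat_vec by (rule L2_set_le_sum) (rule norm_ge_zero)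
  also have "\<dots> \<le> (\<Sum>i\<in>{0..<dim_row A}. \<Sum>j\<in>{0..<dim_col A}. cmod (A $$ (i, j)))"
  proof (rule sum_mono)
    fix i assume i: "i \<in> {0..<dim_row A}"
    then have "cmod ((A *\<^sub>v v) $ i) = cmod (\<Sum>j\<in>{0..<dim_col A}. A $$ (i, j) * v $ j)"
      using dim by (simp add: scalar_prod_def)
    also have "\<dots> \<le> (\<Sum>j\<in>{0..<dim_col A}. cmod (A $$ (i, j) * v $ j))"
      by (rule norm_sum)
    also have "\<dots> \<le> (\<Sum>j\<in>{0..<dim_col A}. cmod (A $$ (i, j)))"
      using entry by (intro sum_mono) (simp add: norm_mult mult_left_le)
    finally show "cmod ((A *\<^sub>v v) $ i) \<le> (\<Sum>j\<in>{0..<dim_col A}. cmod (A $$ (i, j)))" .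
  qed
  finally show "euclid_norm (A *\<^sub>v v)
      \<le> (\<Sum>i\<in>{0..<dim_row A}. \<Sum>j\<in>{0..<dim_col A}. cmod (A $$ (i, j)))" .
qed

text \<open>\<^term>\<open>finsum (ring_mat TYPE(complex) N ())\<close> is the finite sum of \<open>N \<times> N\<close> matrices.\<close>

definition uniform_kreiss :: "nat \<Rightarrow> real \<Rightarrow> complex mat \<Rightarrow> bool" where
  "uniform_kreiss N K A \<longleftrightarrow>
     (\<forall>z n. cmod z > 1 \<longrightarrow>
        op_norm (finsum (ring_mat TYPE(complex) N ()) (\<lambda>k. (1 / z ^ (k + 1)) \<cdot>\<^sub>m (A ^\<^sub>m k)) {0..n})
          \<le> K / (cmod z - 1))"

text \<open>Extended-real valued, so that no finiteness of the supremum is presupposed.\<close>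

definition P_U :: "nat \<Rightarrow> real \<Rightarrow> ereal" where
  "P_U N K = (SUP A\<in>{A \<in> carrier_mat N N. uniform_kreiss N K A}. SUP n\<in>{1..}. ereal (op_norm (A ^\<^sub>m n)))"

lemma finsum_ring_mat:
  assumes "finite I" and "\<And>k. k \<in> I \<Longrightarrow> F k \<in> carrier_mat N N"
  shows "finsum (ring_mat TYPE(complex) N b) F I = mat N N (\<lambda>(i, j). \<Sum>k\<in>I. F k $$ (i, j))"
proof -
  interpret ring "ring_mat TYPE(complex) N b" by (rule ring_mat)
  show ?thesis
    using assms
  proof (induction I rule: finite_induct)
    case empty
    show ?case by (auto simp: ring_mat_simps)
  next
    case (insert k I)
    then have "finsum (ring_mat TYPE(complex) N b) F (insert k I)
        = F k + finsum (ring_mat TYPE(complex) N b) F I"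
      by (subst finsum_insert) (auto simp: ring_mat_simps)
    with insert show ?case by (auto intro!: eq_matI)
  qed
qed

end

theory Submission
  imports Defs "HOL-Analysis.Convex"
begin

text \<open>
  The growth is in fact a power of \<open>N\<close>.  Let \<open>0 < \<delta> < 1/2\<close> and let \<open>A\<close> be the \<open>N \<times> N\<close> weighted
  shift \<open>e\<^sub>j \<mapsto> ((j + 2) / (j + 1))\<^sup>\<delta> e\<^sub>j\<^sub>+\<^sub>1\<close>, so that \<open>A\<^sup>k e\<^sub>j = ((j + k + 1) / (j + 1))\<^sup>\<delta> e\<^sub>j\<^sub>+\<^sub>k\<close>.  Its
  power \<open>A\<^sup>N\<^sup>-\<^sup>1\<close> has the entry \<open>N\<^sup>\<delta>\<close>, hence norm at least \<open>N\<^sup>\<delta>\<close>, which eventually exceeds every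
  power of \<open>log N\<close>.

  The point is that a small \<open>\<delta>\<close> gives a Kreiss constant close to \<open>1\<close>.  For \<open>r = |z| > 1\<close>
  the moduli of the entries of \<open>\<Sum>\<^sub>k z\<^sup>-\<^sup>k\<^sup>-\<^sup>1 A\<^sup>k\<close> are at most \<open>r\<^sup>-\<^sup>(\<^sup>i\<^sup>-\<^sup>j\<^sup>)\<^sup>-\<^sup>1 ((i + 1) / (j + 1))\<^sup>\<delta>\<close> on
  and below the diagonal and \<open>0\<close> above it, whatever the truncation.  The Schur test with the
  weights \<open>u\<^sub>j = (j + 1)\<^sup>-\<^sup>\<delta>\<close> then needs only two estimates.
  In the columns the weight cancels the growth exactly and leaves a geometric series, bounded by
  \<open>1 / (r - 1)\<close>.  In the rows there remains
  \<open>\<Sum>\<^bsub>j \<le> i\<^esub> r\<^sup>-\<^sup>(\<^sup>i\<^sup>-\<^sup>j\<^sup>)\<^sup>-\<^sup>1 ((i + 1) / (j + 1))\<^sup>2\<^sup>\<delta>\<close>; here the geometric factor increases in \<open>j\<close> while the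
  other one decreases, so by Chebyshev's sum inequality the sum is at most the geometric series times
  the average of \<open>((i + 1) / (j + 1))\<^sup>2\<^sup>\<delta>\<close>, that is at most \<open>1 / ((r - 1) (1 - 2 \<delta>))\<close>.  The Kreiss
  constant is therefore at most \<open>1 / sqrt (1 - 2 \<delta>)\<close>, which equals \<open>1 + \<epsilon>\<close> for a suitable \<open>\<delta>\<close>.
\<close>

section \<open>Estimates for the operator norm\<close>

lemma cmod_entry_le_op_norm:
  assumes "i < dim_row A" and "j < dim_col A"
  shows "cmod (A $$ (i, j)) \<le> op_norm A"
proof -
  let ?e = "unit_vec (dim_col A) j :: complex vec"
  have "euclid_norm ?e = 1"
  proof -
    have "(\<Sum>k\<in>{0..<dim_col A}. (cmod (if k = j then 1 else 0))\<^sup>2) = (1::real)"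
      using assms(2) by (subst sum.remove[of _ j]) auto
    then show ?thesis
      by (simp add: euclid_norm_def L2_set_def unit_vec_def)
  qed
  then have "euclid_norm (A *\<^sub>v ?e) \<le> op_norm A"
    unfolding op_norm_def by (intro cSUP_upper op_norm_bdd_above) simp
  moreover have "cmod ((A *\<^sub>v ?e) $ i) \<le> euclid_norm (A *\<^sub>v ?e)"
    unfolding euclid_norm_def using assms(1) by (intro member_le_L2_set) auto
  moreover have "(A *\<^sub>v ?e) $ i = A $$ (i, j)"
    using assms by simp
  ultimately show ?thesis by simp
qed

text \<open>
  Schur's test: splitting \<open>a\<^sub>i\<^sub>j v\<^sub>j\<close> as \<open>(|a\<^sub>i\<^sub>j| q\<^sub>j)\<^sup>1\<^sup>/\<^sup>2\<close> times \<open>(|a\<^sub>i\<^sub>j| / q\<^sub>j)\<^sup>1\<^sup>/\<^sup>2 v\<^sub>j\<close>, the Cauchy-Schwarz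
  inequality brings in the row sums, and exchanging the summations brings in the column sums.
\<close>

lemma schur_test:
  assumes A: "A \<in> carrier_mat m n"
    and R: "0 \<le> R" and C: "0 \<le> C"
    and q: "\<And>j. j < n \<Longrightarrow> 0 < q j"
    and row: "\<And>i. i < m \<Longrightarrow> (\<Sum>j\<in>{0..<n}. cmod (A $$ (i, j)) * q j) \<le> R * p i"
    and col: "\<And>j. j < n \<Longrightarrow> (\<Sum>i\<in>{0..<m}. cmod (A $$ (i, j)) * p i) \<le> C * q j"
  shows "op_norm A \<le> sqrt (R * C)"
  unfolding op_norm_def
proof (rule cSUP_least[OF op_norm_nonempty])
  fix v assume "v \<in> {v \<in> carrier_vec (dim_col A). euclid_norm v \<le> 1}"
  then have dim: "dim_vec v = n" and v: "euclid_norm v \<le> 1" using A by auto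
  have v1: "(\<Sum>j\<in>{0..<n}. (cmod (v $ j))\<^sup>2) \<le> 1"
    using v by (simp add: euclid_norm_def L2_set_def dim)
  have entry: "(cmod ((A *\<^sub>v v) $ i))\<^sup>2
      \<le> R * p i * (\<Sum>j\<in>{0..<n}. cmod (A $$ (i, j)) * (cmod (v $ j))\<^sup>2 / q j)" if i: "i < m" for i
  proof -
    let ?a = "\<lambda>j. sqrt (cmod (A $$ (i, j)) * q j)"
    let ?b = "\<lambda>j. sqrt (cmod (A $$ (i, j)) / q j) * cmod (v $ j)"
    have ab: "?a j * ?b j = cmod (A $$ (i, j) * v $ j)" if "j < n" for j
      using q[OF that] by (simp add: norm_mult real_sqrt_mult real_sqrt_divide)
    have "cmod ((A *\<^sub>v v) $ i) = cmod (\<Sum>j\<in>{0..<n}. A $$ (i, j) * v $ j)"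
      using A dim i by (simp add: scalar_prod_def)
    also have "\<dots> \<le> (\<Sum>j\<in>{0..<n}. cmod (A $$ (i, j) * v $ j))"
      by (rule norm_sum)
    also have "\<dots> = (\<Sum>j\<in>{0..<n}. ?a j * ?b j)"
      by (intro sum.cong) (simp_all only: ab atLeastLessThan_iff)
    finally have "(cmod ((A *\<^sub>v v) $ i))\<^sup>2 \<le> (\<Sum>j\<in>{0..<n}. ?a j * ?b j)\<^sup>2"
      by (intro power_mono) auto
    also have "\<dots> \<le> (\<Sum>j\<in>{0..<n}. (?a j)\<^sup>2) * (\<Sum>j\<in>{0..<n}. (?b j)\<^sup>2)"
      by (rule Cauchy_Schwarz_ineq_sum)
    also have "(\<Sum>j\<in>{0..<n}. (?a j)\<^sup>2) = (\<Sum>j\<in>{0..<n}. cmod (A $$ (i, j)) * q j)"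
      using q by (intro sum.cong) (auto simp: less_imp_le)
    also have "(\<Sum>j\<in>{0..<n}. (?b j)\<^sup>2) = (\<Sum>j\<in>{0..<n}. cmod (A $$ (i, j)) * (cmod (v $ j))\<^sup>2 / q j)"
      using q by (intro sum.cong) (auto simp: less_imp_le power_mult_distrib)
    also have "(\<Sum>j\<in>{0..<n}. cmod (A $$ (i, j)) * q j) *
        (\<Sum>j\<in>{0..<n}. cmod (A $$ (i, j)) * (cmod (v $ j))\<^sup>2 / q j)
      \<le> R * p i * (\<Sum>j\<in>{0..<n}. cmod (A $$ (i, j)) * (cmod (v $ j))\<^sup>2 / q j)"
      using row[OF i] q by (intro mult_right_mono sum_nonneg) (auto simp: less_imp_le)
    finally show ?thesis .
  qed
  have "(\<Sum>i\<in>{0..<m}. (cmod ((A *\<^sub>v v) $ i))\<^sup>2)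
      \<le> (\<Sum>i\<in>{0..<m}. R * p i * (\<Sum>j\<in>{0..<n}. cmod (A $$ (i, j)) * (cmod (v $ j))\<^sup>2 / q j))"
    by (intro sum_mono entry) auto
  also have "\<dots> = (\<Sum>i\<in>{0..<m}. \<Sum>j\<in>{0..<n}.
      R * ((cmod (v $ j))\<^sup>2 / q j) * (cmod (A $$ (i, j)) * p i))"
    by (simp add: sum_distrib_left mult_ac)
  also have "\<dots> = (\<Sum>j\<in>{0..<n}. R * ((cmod (v $ j))\<^sup>2 / q j) * (\<Sum>i\<in>{0..<m}. cmod (A $$ (i, j)) * p i))"
    by (subst sum.swap) (simp add: sum_distrib_left)
  also have "\<dots> \<le> (\<Sum>j\<in>{0..<n}. R * ((cmod (v $ j))\<^sup>2 / q j) * (C * q j))"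
    using q R by (intro sum_mono mult_left_mono col) (auto simp: less_imp_le)
  also have "\<dots> = (\<Sum>j\<in>{0..<n}. R * C * (cmod (v $ j))\<^sup>2)"
    using q by (intro sum.cong) (auto simp: less_imp_neq[symmetric])
  also have "\<dots> = R * C * (\<Sum>j\<in>{0..<n}. (cmod (v $ j))\<^sup>2)"
    by (simp add: sum_distrib_left)
  also have "R * C * (\<Sum>j\<in>{0..<n}. (cmod (v $ j))\<^sup>2) \<le> R * C"
    using v1 R C by (intro mult_left_le) auto
  finally show "euclid_norm (A *\<^sub>v v) \<le> sqrt (R * C)"
    using A by (simp add: euclid_norm_def L2_set_def)
qed

section \<open>Two sums\<close>

lemma sum_inverse_power_le:
  fixes r :: real
  assumes "r > 1"
  shows "(\<Sum>k\<in>{0..<n}. 1 / r ^ (k + 1)) \<le> 1 / (r - 1)"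
proof -
  have "(\<Sum>k\<in>{0..<n}. 1 / r ^ (k + 1)) = (1 - 1 / r ^ n) / (r - 1)"
  proof (induction n)
    case (Suc n)
    have "(1 - 1 / r ^ n) / (r - 1) + 1 / r ^ (n + 1) = (1 - 1 / r ^ Suc n) / (r - 1)"
      using assms by (simp add: field_simps)
    with Suc show ?case by simp
  qed simp
  also have "\<dots> \<le> 1 / (r - 1)"
    using assms by (intro divide_right_mono) auto
  finally show ?thesis .
qed

lemma sum_powr_minus_le:
  fixes \<gamma> :: real
  assumes "0 \<le> \<gamma>" and "\<gamma> < 1"
  shows "(\<Sum>j\<in>{0..<n}. (real j + 1) powr - \<gamma>) \<le> real n powr (1 - \<gamma>) / (1 - \<gamma>)"
proof (induction n)
  case (Suc n)
  have step: "real n powr (1 - \<gamma>) + (1 - \<gamma>) * (real n + 1) powr - \<gamma> \<le> (real n + 1) powr (1 - \<gamma>)"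
  proof (cases "n = 0")
    case False
    \<comment> \<open>Bernoulli's inequality for the exponent \<open>1 - \<gamma>\<close>, in the form of a weighted mean inequality\<close>
    have "real n powr (1 - \<gamma>) * (real n + 1) powr \<gamma> \<le> (1 - \<gamma>) * real n + \<gamma> * (real n + 1)"
      using assms False by (intro Youngs_inequality_0) auto
    also have "\<dots> = real n + 1 - (1 - \<gamma>)" by (simp add: algebra_simps)
    finally have "real n powr (1 - \<gamma>) * (real n + 1) powr \<gamma> * (real n + 1) powr - \<gamma>
        \<le> (real n + 1 - (1 - \<gamma>)) * (real n + 1) powr - \<gamma>"
      by (intro mult_right_mono) auto
    moreover have "(real n + 1) powr \<gamma> * (real n + 1) powr - \<gamma> = 1"
      by (simp add: powr_minus)
    moreover have "(real n + 1) * (real n + 1) powr - \<gamma> = (real n + 1) powr (1 - \<gamma>)"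
      by (subst powr_mult_base) auto
    ultimately show ?thesis by (simp add: algebra_simps)
  qed (use assms in simp)
  have "(\<Sum>j\<in>{0..<Suc n}. (real j + 1) powr - \<gamma>)
      \<le> real n powr (1 - \<gamma>) / (1 - \<gamma>) + (real n + 1) powr - \<gamma>"
    using Suc by simp
  also have "\<dots> = (real n powr (1 - \<gamma>) + (1 - \<gamma>) * (real n + 1) powr - \<gamma>) / (1 - \<gamma>)"
    using assms by (simp add: add_divide_distrib)
  also have "\<dots> \<le> (real n + 1) powr (1 - \<gamma>) / (1 - \<gamma>)"
    using assms by (intro divide_right_mono step) auto
  finally show ?case by (simp add: add.commute)
qed simp

text \<open>
  The geometric factor increases in \<open>j\<close> and the power decreases, so Chebyshev's sum inequality
  separates them.
\<close>

lemma sum_inverse_power_mult_powr_le: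
  fixes r \<gamma> :: real
  assumes r: "r > 1" and \<gamma>: "0 \<le> \<gamma>" "\<gamma> < 1"
  shows "(\<Sum>j\<in>{0..<Suc i}. 1 / r ^ (i - j + 1) * ((real i + 1) / (real j + 1)) powr \<gamma>)
    \<le> 1 / (r - 1) / (1 - \<gamma>)"
proof -
  let ?n = "Suc i"
  let ?a = "\<lambda>j. 1 / r ^ (i - j + 1)"
  let ?b = "\<lambda>j. ((real i + 1) / (real j + 1)) powr \<gamma>"
  have "(\<Sum>j\<in>{0..<?n}. ?a j) = (\<Sum>j\<in>{0..<?n}. 1 / r ^ (j + 1))"
    by (subst sum.atLeastLessThan_rev) (auto intro!: sum.cong)
  then have a: "(\<Sum>j\<in>{0..<?n}. ?a j) \<le> 1 / (r - 1)"
    using sum_inverse_power_le[OF r, of ?n] by simp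
  have "(\<Sum>j\<in>{0..<?n}. ?b j) = real ?n powr \<gamma> * (\<Sum>j\<in>{0..<?n}. (real j + 1) powr - \<gamma>)"
    unfolding sum_distrib_left
    by (intro sum.cong) (auto simp: powr_divide powr_minus field_simps)
  also have "\<dots> \<le> real ?n powr \<gamma> * (real ?n powr (1 - \<gamma>) / (1 - \<gamma>))"
    using \<gamma> by (intro mult_left_mono sum_powr_minus_le) auto
  also have "\<dots> = real ?n / (1 - \<gamma>)"
    by (simp flip: powr_add)
  finally have b: "(\<Sum>j\<in>{0..<?n}. ?b j) \<le> real ?n / (1 - \<gamma>)" .
  have "real ?n * (\<Sum>j\<in>{0..<?n}. ?a j * ?b j) \<le> (\<Sum>j\<in>{0..<?n}. ?a j) * (\<Sum>j\<in>{0..<?n}. ?b j)"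
    using r \<gamma>
    by (intro Chebyshev_sum_upper)
      (auto intro!: divide_left_mono power_increasing powr_mono2 mult_pos_pos zero_less_power)
  also have "\<dots> \<le> 1 / (r - 1) * (real ?n / (1 - \<gamma>))"
    using r \<gamma> by (intro mult_mono a b sum_nonneg) auto
  also have "\<dots> = real ?n * (1 / (r - 1) / (1 - \<gamma>))"
    by simp
  finally show ?thesis
    by (rule mult_left_le_imp_le) simp
qed

section \<open>The uniform Kreiss condition\<close>

lemma uniform_kreissI:
  assumes A: "A \<in> carrier_mat N N"
    and bound: "\<And>z n. cmod z > 1 \<Longrightarrow>
      op_norm (mat N N (\<lambda>(i, j). \<Sum>k\<in>{0..n}. 1 / z ^ (k + 1) * (A ^\<^sub>m k) $$ (i, j))) \<le> K / (cmod z - 1)"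
  shows "uniform_kreiss N K A"
  unfolding uniform_kreiss_def
proof (intro allI impI)
  fix z :: complex and n :: nat
  assume z: "cmod z > 1"
  have "finsum (ring_mat TYPE(complex) N ()) (\<lambda>k. (1 / z ^ (k + 1)) \<cdot>\<^sub>m (A ^\<^sub>m k)) {0..n}
      = mat N N (\<lambda>(i, j). \<Sum>k\<in>{0..n}. 1 / z ^ (k + 1) * (A ^\<^sub>m k) $$ (i, j))"
    using A by (subst finsum_ring_mat) (auto intro!: eq_matI sum.cong)
  with bound[OF z] show "op_norm (finsum (ring_mat TYPE(complex) N ())
      (\<lambda>k. (1 / z ^ (k + 1)) \<cdot>\<^sub>m (A ^\<^sub>m k)) {0..n}) \<le> K / (cmod z - 1)"
    by simp
qed

lemma uniform_kreiss_mono: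
  assumes "uniform_kreiss N K A" and "K \<le> L"
  shows "uniform_kreiss N L A"
  unfolding uniform_kreiss_def
proof (intro allI impI)
  fix z :: complex and n :: nat
  assume z: "cmod z > 1"
  then have "op_norm (finsum (ring_mat TYPE(complex) N ())
      (\<lambda>k. (1 / z ^ (k + 1)) \<cdot>\<^sub>m (A ^\<^sub>m k)) {0..n}) \<le> K / (cmod z - 1)"
    using assms(1) unfolding uniform_kreiss_def by blast
  also have "\<dots> \<le> L / (cmod z - 1)"
    using z assms(2) by (intro divide_right_mono) auto
  finally show "op_norm (finsum (ring_mat TYPE(complex) N ())
      (\<lambda>k. (1 / z ^ (k + 1)) \<cdot>\<^sub>m (A ^\<^sub>m k)) {0..n}) \<le> L / (cmod z - 1)" .
qed

lemma entry_le_P_U: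
  assumes "A \<in> carrier_mat N N" and "uniform_kreiss N K A"
    and "n \<ge> 1" and "i < N" and "j < N"
  shows "ereal (cmod ((A ^\<^sub>m n) $$ (i, j))) \<le> P_U N K"
proof -
  have "ereal (cmod ((A ^\<^sub>m n) $$ (i, j))) \<le> ereal (op_norm (A ^\<^sub>m n))"
    using assms by (auto intro!: cmod_entry_le_op_norm)
  also have "\<dots> \<le> (SUP n\<in>{1..}. ereal (op_norm (A ^\<^sub>m n)))"
    using assms by (intro SUP_upper) auto
  also have "\<dots> \<le> P_U N K"
    unfolding P_U_def using assms by (intro SUP_upper) auto
  finally show ?thesis .
qed

lemma uniform_kreiss_one_mat: "uniform_kreiss N 1 (1\<^sub>m N)"
proof (rule uniform_kreissI)
  fix z :: complex and n :: nat
  assume z: "cmod z > 1"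
  let ?s = "\<Sum>k\<in>{0..n}. 1 / z ^ (k + 1)"
  have pow: "(1\<^sub>m N :: complex mat) ^\<^sub>m k = 1\<^sub>m N" for k
    by (induction k) auto
  define S where
    "S = mat N N (\<lambda>(i, j). \<Sum>k\<in>{0..n}. 1 / z ^ (k + 1) * (1\<^sub>m N ^\<^sub>m k) $$ (i, j))"
  have "cmod ?s \<le> (\<Sum>k\<in>{0..<Suc n}. 1 / cmod z ^ (k + 1))"
    unfolding atLeastLessThanSuc_atLeastAtMost
    by (rule order.trans[OF norm_sum]) (simp add: norm_divide norm_mult norm_power)
  also have "\<dots> \<le> 1 / (cmod z - 1)"
    using z by (rule sum_inverse_power_le)
  finally have s: "cmod ?s \<le> 1 / (cmod z - 1)" .
  have S: "cmod (S $$ (i, j)) = (if i = j then cmod ?s else 0)" if "i < N" "j < N" for i j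
    using that by (simp add: S_def pow)
  have "op_norm S \<le> sqrt (1 / (cmod z - 1) * (1 / (cmod z - 1)))"
    using z s
    by (intro schur_test[where p = "\<lambda>_. 1" and q = "\<lambda>_. 1" and m = N and n = N])
      (simp_all add: S, simp add: S_def)
  then show "op_norm (mat N N (\<lambda>(i, j). \<Sum>k\<in>{0..n}. 1 / z ^ (k + 1) * (1\<^sub>m N ^\<^sub>m k) $$ (i, j)))
      \<le> 1 / (cmod z - 1)"
    using z unfolding real_sqrt_abs2 S_def by simp
qed simp

section \<open>The weighted shift\<close>

definition weighted_shift :: "nat \<Rightarrow> real \<Rightarrow> complex mat" where
  "weighted_shift N \<delta> = mat N N (\<lambda>(i, j).
     if i = j + 1 then of_real (((real i + 1) / (real j + 1)) powr \<delta>) else 0)"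

lemma weighted_shift_carrier [simp]: "weighted_shift N \<delta> \<in> carrier_mat N N"
  by (simp add: weighted_shift_def)

lemma weighted_shift_power:
  "weighted_shift N \<delta> ^\<^sub>m k = mat N N (\<lambda>(i, j).
     if i = j + k then of_real (((real i + 1) / (real j + 1)) powr \<delta>) else 0)"
proof (induction k)
  case 0
  show ?case
    by (rule eq_matI) (auto simp: weighted_shift_def)
next
  case (Suc k)
  let ?w = "\<lambda>i j. complex_of_real (((real i + 1) / (real j + 1)) powr \<delta>)"
  show ?case
  proof (rule eq_matI)
    fix i j
    assume "i < dim_row (mat N N (\<lambda>(i, j). if i = j + Suc k then ?w i j else 0))"
      and "j < dim_col (mat N N (\<lambda>(i, j). if i = j + Suc k then ?w i j else 0))"
    then have ij: "i < N" "j < N" by auto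
    have "(weighted_shift N \<delta> ^\<^sub>m Suc k) $$ (i, j)
        = (\<Sum>l\<in>{0..<N}. (if i = l + k then ?w i l else 0) * (if l = j + 1 then ?w l j else 0))"
      using ij by (simp add: Suc) (simp add: weighted_shift_def scalar_prod_def)
    also have "\<dots> = (\<Sum>l\<in>{0..<N}. if l = j + 1 then if i = j + 1 + k then ?w i (j + 1) * ?w (j + 1) j else 0 else 0)"
      by (intro sum.cong) auto
    also have "\<dots> = (if i = j + Suc k then ?w i (j + 1) * ?w (j + 1) j else 0)"
      using ij by auto
    also have "?w i (j + 1) * ?w (j + 1) j = ?w i j"
      by (simp flip: powr_mult of_real_mult)
    finally show "(weighted_shift N \<delta> ^\<^sub>m Suc k) $$ (i, j)
        = mat N N (\<lambda>(i, j). if i = j + Suc k then ?w i j else 0) $$ (i, j)"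
      using ij by simp
  qed (auto simp: weighted_shift_def)
qed

text \<open>
  With the Schur weights \<open>(j + 1)\<^sup>-\<^sup>\<delta>\<close> the growth \<open>((i + 1) / (j + 1))\<^sup>\<delta>\<close> disappears from the column
  sums, while in the row sums its exponent doubles to \<open>2 \<delta>\<close>, which the hypothesis keeps below \<open>1\<close>.
\<close>

lemma uniform_kreiss_weighted_shift:
  assumes \<delta>: "0 \<le> \<delta>" "\<delta> < 1 / 2"
  shows "uniform_kreiss N (1 / sqrt (1 - 2 * \<delta>)) (weighted_shift N \<delta>)"
proof (rule uniform_kreissI)
  fix z :: complex and n :: nat
  assume z: "cmod z > 1"
  define r where "r = cmod z"
  have r: "r > 1" using z by (simp add: r_def)
  let ?S = "mat N N (\<lambda>(i, j). \<Sum>k\<in>{0..n}. 1 / z ^ (k + 1) * (weighted_shift N \<delta> ^\<^sub>m k) $$ (i, j))"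
  let ?u = "\<lambda>j. (real j + 1) powr - \<delta>"
  let ?w = "\<lambda>i j. ((real i + 1) / (real j + 1)) powr \<delta>"
  have S: "cmod (?S $$ (i, j)) \<le> (if j \<le> i then 1 / r ^ (i - j + 1) * ?w i j else 0)"
    if ij: "i < N" "j < N" for i j
  proof -
    have "?S $$ (i, j) = (\<Sum>k\<in>{0..n}. 1 / z ^ (k + 1) * (weighted_shift N \<delta> ^\<^sub>m k) $$ (i, j))"
      using ij by simp
    also have "\<dots> = (\<Sum>k\<in>{0..n}. if k = i - j
        then if j \<le> i then 1 / z ^ (i - j + 1) * of_real (?w i j) else 0 else 0)"
      using ij by (intro sum.cong) (auto simp: weighted_shift_power)
    also have "\<dots> = (if i - j \<le> n \<and> j \<le> i then 1 / z ^ (i - j + 1) * of_real (?w i j) else 0)"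
      by simp
    finally show ?thesis
      by (auto simp: norm_mult norm_divide norm_power r_def)
  qed
  have "op_norm ?S \<le> sqrt (1 / (r - 1) / (1 - 2 * \<delta>) * (1 / (r - 1)))"
  proof (rule schur_test[where p = ?u and q = ?u and m = N and n = N])
    fix i assume i: "i < N"
    have "(\<Sum>j\<in>{0..<N}. cmod (?S $$ (i, j)) * ?u j)
        \<le> (\<Sum>j\<in>{0..<N}. (if j \<le> i then 1 / r ^ (i - j + 1) * ?w i j else 0) * ?u j)"
      using i by (intro sum_mono mult_right_mono S) auto
    also have "\<dots> = (\<Sum>j\<in>{0..<Suc i}. 1 / r ^ (i - j + 1) * ?w i j * ?u j)"
      using i by (intro sum.mono_neutral_cong_right) auto
    also have "\<dots> = (\<Sum>j\<in>{0..<Suc i}. 1 / r ^ (i - j + 1) *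
        ((real i + 1) / (real j + 1)) powr (2 * \<delta>)) * ?u i"
      unfolding sum_distrib_right
      by (intro sum.cong refl) (simp only: mult_2[of \<delta>] powr_add, simp add: powr_divide powr_minus field_simps)
    also have "\<dots> \<le> 1 / (r - 1) / (1 - 2 * \<delta>) * ?u i"
      using r \<delta> by (intro mult_right_mono sum_inverse_power_mult_powr_le) auto
    finally show "(\<Sum>j\<in>{0..<N}. cmod (?S $$ (i, j)) * ?u j) \<le> 1 / (r - 1) / (1 - 2 * \<delta>) * ?u i" .
  next
    fix j assume j: "j < N"
    have "(\<Sum>i\<in>{0..<N}. cmod (?S $$ (i, j)) * ?u i)
        \<le> (\<Sum>i\<in>{0..<N}. (if j \<le> i then 1 / r ^ (i - j + 1) * ?w i j else 0) * ?u i)"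
      using j by (intro sum_mono mult_right_mono S) auto
    also have "\<dots> = (\<Sum>i\<in>{j..<N}. 1 / r ^ (i - j + 1) * ?w i j * ?u i)"
      by (intro sum.mono_neutral_cong_right) auto
    also have "\<dots> = (\<Sum>i\<in>{j..<N}. 1 / r ^ (i - j + 1)) * ?u j"
      unfolding sum_distrib_right
      by (intro sum.cong refl) (simp add: powr_divide powr_minus field_simps)
    also have "(\<Sum>i\<in>{j..<N}. 1 / r ^ (i - j + 1)) = (\<Sum>k\<in>{0..<N - j}. 1 / r ^ (k + 1))"
      by (subst sum.atLeastLessThan_shift_0) simp
    also have "\<dots> * ?u j \<le> 1 / (r - 1) * ?u j"
      using r by (intro mult_right_mono sum_inverse_power_le) auto
    finally show "(\<Sum>i\<in>{0..<N}. cmod (?S $$ (i, j)) * ?u i) \<le> 1 / (r - 1) * ?u j" .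
  qed (use r \<delta> in auto)
  also have "\<dots> = 1 / sqrt (1 - 2 * \<delta>) / (r - 1)"
    using r by (simp add: real_sqrt_mult real_sqrt_divide)
  finally show "op_norm ?S \<le> 1 / sqrt (1 - 2 * \<delta>) / (cmod z - 1)"
    by (simp add: r_def)
qed simp

section \<open>Growth of the powers\<close>

text \<open>
  The exponent solves \<open>1 / sqrt (1 - 2 \<delta>) = K\<close>.  The weighted shift of size \<open>1\<close> is the zero matrix, so there the identity serves as the witness.
\<close>

lemma P_U_ge_powr:
  assumes K: "K \<ge> 1" and N: "N \<ge> 1"
  shows "ereal (real N powr ((1 - 1 / K\<^sup>2) / 2)) \<le> P_U N K"
proof (cases "N = 1")
  case True
  have "ereal (cmod ((1\<^sub>m N ^\<^sub>m 1) $$ (0, 0))) \<le> P_U N K"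
    using uniform_kreiss_mono[OF uniform_kreiss_one_mat K] N by (intro entry_le_P_U) auto
  then show ?thesis using True by (simp add: one_ereal_def)
next
  case False
  define \<delta> where "\<delta> = (1 - 1 / K\<^sup>2) / 2"
  have "0 \<le> \<delta>" "\<delta> < 1 / 2" and *: "1 - 2 * \<delta> = (1 / K)\<^sup>2"
    using K by (auto simp: \<delta>_def power_divide diff_divide_distrib)
  moreover have "1 / sqrt (1 - 2 * \<delta>) = K"
    using K unfolding * by simp
  ultimately have kreiss: "uniform_kreiss N K (weighted_shift N \<delta>)"
    using uniform_kreiss_weighted_shift[of \<delta> N] by simp
  have "real N powr \<delta> = cmod ((weighted_shift N \<delta> ^\<^sub>m (N - 1)) $$ (N - 1, 0))"
    using N by (simp add: weighted_shift_power of_nat_diff)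
  also have "ereal \<dots> \<le> P_U N K"
    using N False kreiss by (intro entry_le_P_U) auto
  finally show ?thesis by (simp add: \<delta>_def)
qed

theorem theorem3p3:
  fixes \<epsilon> :: real and m :: nat
  assumes "\<epsilon> > 0"
  shows "\<exists>C::real. C > 0 \<and> (\<forall>N::nat. N \<ge> 1 \<longrightarrow> P_U N (1 + \<epsilon>) \<ge> ereal (C * (ln (real N)) ^ m))"
proof -
  define \<delta> where "\<delta> = (1 - 1 / (1 + \<epsilon>)\<^sup>2) / 2"
  have \<delta>: "\<delta> > 0" using assms by (simp add: \<delta>_def)
  \<comment> \<open>\<open>m + 1\<close> in place of \<open>m\<close> keeps the exponent \<open>a\<close> meaningful for \<open>m = 0\<close>\<close>
  define a where "a = \<delta> / (real m + 1)"
  have a: "a > 0" "a * real m \<le> \<delta>" using \<delta> by (auto simp: a_def field_simps)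
  have "ereal (a ^ m * (ln (real N)) ^ m) \<le> P_U N (1 + \<epsilon>)" if N: "N \<ge> 1" for N :: nat
  proof -
    have "(a * ln (real N)) ^ m \<le> (real N powr a) ^ m"
      using ln_powr_bound[of "real N" a] a N by (intro power_mono) (auto simp: field_simps)
    also have "\<dots> = real N powr (a * real m)"
      using N by (simp add: powr_powr flip: powr_realpow)
    also have "\<dots> \<le> real N powr \<delta>"
      using a N by (intro powr_mono) auto
    finally have "ereal (a ^ m * (ln (real N)) ^ m) \<le> ereal (real N powr \<delta>)"
      by (simp add: power_mult_distrib)
    also have "\<dots> \<le> P_U N (1 + \<epsilon>)"
      unfolding \<delta>_def using assms N by (intro P_U_ge_powr) auto
    finally show ?thesis .
  qed
  with a show ?thesis by (intro exI[of _ "a ^ m"]) auto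
qed

end
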